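(* Let $0<c<1$, let $m\ge0$ and let $f,g\in X_c^*$ satisfy $P_m^*f=f$ and $P_m^*g=0$. Then $$\|f+g\|_{X_c^*}^2\ge\|f\|_{X_c^*}^2+\|g\|_{X_c^*}^2.$$
   Context: All Banach spaces are real; $E^*$ is the dual of $E$ with the dual norm. Definition of $X_c$. A norm $N$ on $\mathbb R^2$ is absolute if $N(s,t)=N(|s|,|t|)$ and normalized if $N(1,0)=N(0,1)=1$. Given a sequence $(N_n)_{n\ge1}$ of absolute normalized norms on $\mathbb R^2$, define norms $M_n$ on $\mathbb R^{n+1}$ by $M_0(x_0)=|x_0|$ and $M_n(x_0,\dots,x_n)=N_n(M_{n-1}(x_0,\dots,x_{n-1}),|x_n|)$ for $n\ge1$. For a finitely supported real sequence $x=(x_j)_{j\ge0}\in c_{00}$ put $\|x\|=M_n(x_0,\dots,x_n)$ for any $n$ with $x_j=0$ for all $j>n$ (this is independent of $n$). $A(N_n)$ denotes the completion of $c_{00}$ in this norm, with canonical basis $(e_j)_{j\ge0}$. For $0<c<1$ and $n\ge1$ let $$N_{n,c}(s,t)=\left[(1-c^{2n})|t|^{2n}+(s^2+c^2t^2)^n\right]^{1/(2n)},$$ which is an absolute normalized norm on $\mathbb R^2$, and set $X_c:=A(N_{n,c})$. The canonical basis $(e_j)_{j\ge0}$ of $X_c$ is a ($1$-unconditional) Schauder basis; $P_m$ denotes the canonical projection of $X_c$ onto $\operatorname{span}\{e_0,\dots,e_m\}$, i.e. $P_m\bigl(\sum_{j\ge0}x_je_j\bigr)=\sum_{j=0}^m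 x_je_j$, and $P_m^*$ is its adjoint on $X_c^*$. *)

theory Defs
  imports "HOL-Analysis.Analysis"
begin

text \<open>
  A norm on the plane is a curried function \<open>real \<Rightarrow> real \<Rightarrow> real\<close>. Vectors
  of \<open>\<real>\<^sup>n\<^sup>+\<^sup>1\<close> are sequences of which only the entries \<open>0, \<dots>, n\<close> are read.
\<close>

fun iterated_norm :: "(nat \<Rightarrow> real \<Rightarrow> real \<Rightarrow> real) \<Rightarrow> nat \<Rightarrow> (nat \<Rightarrow> real) \<Rightarrow> real" where
  "iterated_norm N 0 x = \<bar>x 0\<bar>"
| "iterated_norm N (Suc n) x = N (Suc n) (iterated_norm N n x) \<bar>x (Suc n)\<bar>"

definition c00 :: "(nat \<Rightarrow> real) set" where
  "c00 = {x. finite {j. x j \<noteq> 0}}"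

text \<open>
  The norm of a finitely supported sequence is read off at the least admissible
  index; by \<open>c00_norm_eq\<close> below every other admissible index gives the same value.
\<close>

definition c00_norm :: "(nat \<Rightarrow> real \<Rightarrow> real \<Rightarrow> real) \<Rightarrow> (nat \<Rightarrow> real) \<Rightarrow> real" where
  "c00_norm N x = iterated_norm N (LEAST n. \<forall>j>n. x j = 0) x"

definition plane_norm :: "real \<Rightarrow> nat \<Rightarrow> real \<Rightarrow> real \<Rightarrow> real" where
  "plane_norm c n s t =
     root (2 * n) ((1 - c ^ (2 * n)) * \<bar>t\<bar> ^ (2 * n) + (s\<^sup>2 + c\<^sup>2 * t\<^sup>2) ^ n)"

text \<open>
  A completion of \<open>c00\<close> depends on the norms \<open>N\<close>, so it cannot be a single type.
  It is given instead as a Banach space together with a linear isometric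
  embedding \<open>\<iota>\<close> of \<open>c00\<close> with dense range; this determines it up to isometric
  isomorphism over \<open>c00\<close>. The values of \<open>\<iota>\<close> outside \<open>c00\<close> are irrelevant.
\<close>

definition is_completion ::
    "(nat \<Rightarrow> real \<Rightarrow> real \<Rightarrow> real) \<Rightarrow> ((nat \<Rightarrow> real) \<Rightarrow> 'a::banach) \<Rightarrow> bool" where
  "is_completion N \<iota> \<longleftrightarrow>
     (\<forall>x\<in>c00. \<forall>y\<in>c00. \<iota> (\<lambda>j. x j + y j) = \<iota> x + \<iota> y) \<and>
     (\<forall>a. \<forall>x\<in>c00. \<iota> (\<lambda>j. a * x j) = a *\<^sub>R \<iota> x) \<and>
     (\<forall>x\<in>c00. norm (\<iota> x) = c00_norm N x) \<and>
     closure (\<iota> ` c00) = UNIV"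

definition canonical_basis :: "((nat \<Rightarrow> real) \<Rightarrow> 'a) \<Rightarrow> nat \<Rightarrow> 'a" where
  "canonical_basis \<iota> j = \<iota> (\<lambda>i. if i = j then 1 else 0)"

text \<open>Meaningful when \<open>e\<close> is a Schauder basis, i.e. when the expansion exists and is unique.\<close>

definition basis_coeff :: "(nat \<Rightarrow> 'a::real_normed_vector) \<Rightarrow> 'a \<Rightarrow> nat \<Rightarrow> real" where
  "basis_coeff e x = (THE a. (\<lambda>j. a j *\<^sub>R e j) sums x)"

definition basis_proj :: "(nat \<Rightarrow> 'a::real_normed_vector) \<Rightarrow> nat \<Rightarrow> 'a \<Rightarrow> 'a" where
  "basis_proj e m x = (\<Sum>j\<le>m. basis_coeff e x j *\<^sub>R e j)"

text \<open>
  The adjoint of an operator \<open>T\<close> applied to a functional \<open>f\<close>, as a plain function: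
  \<open>T\<close> is not bundled with a proof of boundedness.
\<close>

definition dual_adjoint ::
    "('a::real_normed_vector \<Rightarrow> 'b::real_normed_vector) \<Rightarrow> ('b \<Rightarrow>\<^sub>L real) \<Rightarrow> 'a \<Rightarrow> real" where
  "dual_adjoint T f = (\<lambda>x. blinfun_apply f (T x))"

lemma iterated_norm_stable:
  assumes N0: "\<And>n s. n \<ge> 1 \<Longrightarrow> N n s 0 = \<bar>s\<bar>"
    and Npos: "\<And>n s t. n \<ge> 1 \<Longrightarrow> N n s t \<ge> 0"
    and "k \<le> n" and "\<forall>j>k. x j = 0"
  shows "iterated_norm N n x = iterated_norm N k x"
  using \<open>k \<le> n\<close>
proof (induction n rule: dec_induct)
  case (step n)
  have "iterated_norm N n x \<ge> 0"
    by (cases n) (auto simp: Npos)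
  with step assms(4) show ?case by (simp add: N0)
qed simp

lemma c00_norm_eq:
  assumes N0: "\<And>n s. n \<ge> 1 \<Longrightarrow> N n s 0 = \<bar>s\<bar>"
    and Npos: "\<And>n s t. n \<ge> 1 \<Longrightarrow> N n s t \<ge> 0"
    and x: "\<forall>j>n. x j = 0"
  shows "c00_norm N x = iterated_norm N n x"
proof -
  have "\<forall>j>(LEAST n. \<forall>j>n. x j = 0). x j = 0"
    by (rule LeastI[where P = "\<lambda>n. \<forall>j>n. x j = 0", OF x])
  moreover have "(LEAST n. \<forall>j>n. x j = 0) \<le> n"
    by (rule Least_le[where P = "\<lambda>n. \<forall>j>n. x j = 0", OF x])
  ultimately show ?thesis
    unfolding c00_norm_def by (intro iterated_norm_stable[symmetric] N0 Npos)
qed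

lemma plane_norm_zero:
  assumes "n \<ge> 1"
  shows "plane_norm c n s 0 = \<bar>s\<bar>"
proof -
  have "(s\<^sup>2) ^ n = \<bar>s\<bar> ^ (2 * n)"
    by (simp add: power_mult)
  then show ?thesis
    using assms real_root_power_cancel[of "2 * n" "\<bar>s\<bar>"]
    by (simp add: plane_norm_def power_0_left)
qed

lemma plane_norm_nonneg:
  assumes "0 < c" "c < 1"
  shows "plane_norm c n s t \<ge> 0"
proof -
  have "c ^ (2 * n) \<le> 1" using assms by (simp add: power_le_one)
  then have "0 \<le> (1 - c ^ (2 * n)) * \<bar>t\<bar> ^ (2 * n)"
    by simp
  moreover have "0 \<le> (s\<^sup>2 + c\<^sup>2 * t\<^sup>2) ^ n"
    by (rule zero_le_power) simp
  ultimately show ?thesis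
    unfolding plane_norm_def by (intro real_root_ge_zero add_nonneg_nonneg)
qed

lemma c00_norm_plane_norm:
  assumes "0 < c" "c < 1" "\<forall>j>n. x j = 0"
  shows "c00_norm (plane_norm c) x = iterated_norm (plane_norm c) n x"
  by (rule c00_norm_eq) (use assms in \<open>auto simp: plane_norm_zero plane_norm_nonneg\<close>)

end

theory Submission imports Defs begin

text \<open>
  The statement is dual to an upper 2-estimate in the space itself: if \<open>u\<close> is supported on
  \<open>{0..m}\<close> and \<open>v\<close> on \<open>{m<..}\<close>, then \<open>\<parallel>u + v\<parallel>\<^sup>2 \<le> \<parallel>u\<parallel>\<^sup>2 + \<parallel>v\<parallel>\<^sup>2\<close>
  (\<open>iterated_norm_upper_2_estimate\<close>). Coordinates are added one at a time. While \<open>n \<le> m\<close>, the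
  vector \<open>v\<close> vanishes. For \<open>n > m\<close> the entry \<open>u n\<close> vanishes, and the step is the inequality
  \<open>N\<^sub>n(s, t)\<^sup>2 \<le> a\<^sup>2 + N\<^sub>n(b, t)\<^sup>2\<close> whenever \<open>s\<^sup>2 \<le> a\<^sup>2 + b\<^sup>2\<close> (\<open>plane_norm_upper_2_estimate\<close>).
  This holds because \<open>N\<^sub>n(s, t)\<^sup>2\<close> is the \<open>\<ell>\<^sub>n\<close>-norm on the plane of a pair whose first entry
  is \<open>s\<^sup>2 + c\<^sup>2 t\<^sup>2\<close> and whose second entry depends only on \<open>t\<close>: raising the first entry by
  \<open>a\<^sup>2\<close> raises an \<open>\<ell>\<^sub>n\<close>-norm by at most \<open>a\<^sup>2\<close>.

  For the dual statement, \<open>f\<close> sees only the head of a vector and \<open>g\<close> only its tail, and cutting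
  a vector down to its head or its tail does not increase the norm. Gluing the head of \<open>x\<close> to the
  tail of \<open>y\<close> therefore gives \<open>f x + g y \<le> \<parallel>f + g\<parallel> sqrt (\<parallel>x\<parallel>\<^sup>2 + \<parallel>y\<parallel>\<^sup>2)\<close>, first for finitely
  supported \<open>x\<close> and \<open>y\<close>, then by density for all. Letting \<open>x\<close> and \<open>y\<close> almost norm \<open>f\<close> and \<open>g\<close>,
  with \<open>\<parallel>x\<parallel> = \<parallel>f\<parallel>\<close> and \<open>\<parallel>y\<parallel> = \<parallel>g\<parallel>\<close>, yields the claim
  (\<open>norm_blinfun_sq_add_le\<close>).
\<close>

section \<open>The norms on the plane\<close>

text \<open>This is convexity of the \<open>n\<close>-th power on the nonnegative reals.\<close>

lemma power_increment_mono:
  fixes a w r :: real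
  assumes "0 \<le> a" "0 \<le> w" "w \<le> r"
  shows "(a + w) ^ n - w ^ n \<le> (a + r) ^ n - r ^ n"
proof (induction n)
  case (Suc n)
  have split: "(a + z) ^ Suc n - z ^ Suc n = (a + z) * ((a + z) ^ n - z ^ n) + a * z ^ n" for z :: real
    by (simp add: algebra_simps)
  have "(a + w) * ((a + w) ^ n - w ^ n) \<le> (a + r) * ((a + r) ^ n - r ^ n)"
    using assms Suc by (intro mult_mono) (auto intro: power_mono)
  moreover have "a * w ^ n \<le> a * r ^ n"
    using assms by (intro mult_left_mono power_mono) auto
  ultimately show ?case unfolding split by linarith
qed simp

lemma plane_norm_power:
  assumes "0 < c" "c < 1" "n \<ge> 1"
  shows "plane_norm c n s t ^ (2 * n) =
    (1 - c ^ (2 * n)) * \<bar>t\<bar> ^ (2 * n) + (s\<^sup>2 + c\<^sup>2 * t\<^sup>2) ^ n"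
proof -
  have "c ^ (2 * n) \<le> 1" using assms by (simp add: power_le_one)
  then show ?thesis
    unfolding plane_norm_def using assms(3)
    by (intro real_root_pow_pos2) (auto intro!: add_nonneg_nonneg)
qed

lemma plane_norm_mono:
  assumes "0 < c" "c < 1" "0 \<le> s" "s \<le> s'" "\<bar>t\<bar> \<le> \<bar>t'\<bar>" "n \<ge> 1"
  shows "plane_norm c n s t \<le> plane_norm c n s' t'"
proof -
  have "c ^ (2 * n) \<le> 1" using assms by (simp add: power_le_one)
  moreover have "s\<^sup>2 \<le> s'\<^sup>2" "t\<^sup>2 \<le> t'\<^sup>2"
    using assms by (auto intro: power_mono simp: abs_le_square_iff[symmetric])
  ultimately show ?thesis
    unfolding plane_norm_def using assms
    by (auto intro!: real_root_le_mono add_mono mult_left_mono power_mono)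
qed

lemma le_plane_norm:
  assumes "0 < c" "c < 1" "n \<ge> 1" "0 \<le> s"
  shows "s \<le> plane_norm c n s t"
  using plane_norm_mono[of c s s 0 t n] assms by (simp add: plane_norm_zero)

lemma abs_le_plane_norm:
  assumes "0 < c" "c < 1" "n \<ge> 1" "0 \<le> s"
  shows "\<bar>t\<bar> \<le> plane_norm c n s t"
proof -
  \<comment> \<open>The weights are chosen so that \<open>N\<^sub>n (0, t) = \<bar>t\<bar>\<close>.\<close>
  have "(0\<^sup>2 + c\<^sup>2 * t\<^sup>2) ^ n = c ^ (2 * n) * \<bar>t\<bar> ^ (2 * n)"
    by (simp add: power_mult power_mult_distrib)
  then have "plane_norm c n 0 t ^ (2 * n) = \<bar>t\<bar> ^ (2 * n)"
    unfolding plane_norm_power[OF assms(1-3)] by (simp add: algebra_simps)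
  then have "\<bar>t\<bar> = plane_norm c n 0 t"
    by (rule power_eq_imp_eq_base[OF sym]) (use assms in \<open>simp_all add: plane_norm_nonneg\<close>)
  also have "plane_norm c n 0 t \<le> plane_norm c n s t"
    by (rule plane_norm_mono) (use assms in auto)
  finally show ?thesis .
qed

text \<open>
  With \<open>r = N\<^sub>n(b, t)\<^sup>2\<close> and \<open>w = b\<^sup>2 + c\<^sup>2 t\<^sup>2\<close> one has \<open>w \<le> r\<close> and \<open>r ^ n - w ^ n\<close> depends only
  on \<open>t\<close>, so the claim, raised to the power \<open>n\<close>, compares the increments of the \<open>n\<close>-th
  power over the step \<open>a\<^sup>2\<close> from \<open>w\<close> and from \<open>r\<close>.
\<close>

lemma plane_norm_upper_2_estimate:
  assumes c: "0 < c" "c < 1" and n: "n \<ge> 1" and s: "s\<^sup>2 \<le> a\<^sup>2 + b\<^sup>2"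
  shows "(plane_norm c n s t)\<^sup>2 \<le> a\<^sup>2 + (plane_norm c n b t)\<^sup>2"
proof -
  define k where "k = (1 - c ^ (2 * n)) * \<bar>t\<bar> ^ (2 * n)"
  define w where "w = b\<^sup>2 + c\<^sup>2 * t\<^sup>2"
  define r where "r = (plane_norm c n b t)\<^sup>2"
  have "c ^ (2 * n) \<le> 1" using c by (simp add: power_le_one)
  then have k: "0 \<le> k" by (simp add: k_def)
  have w: "0 \<le> w" by (simp add: w_def)
  have r: "0 \<le> r" by (simp add: r_def)
  have rn: "r ^ n = k + w ^ n"
    using plane_norm_power[OF c n, of b t] by (simp add: r_def k_def w_def power_mult)
  have "w \<le> r"
  proof (rule power_le_imp_le_base)
    show "w ^ Suc (n - 1) \<le> r ^ Suc (n - 1)" using rn k n by simp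
  qed (fact r)
  then have step: "(a\<^sup>2 + w) ^ n - w ^ n \<le> (a\<^sup>2 + r) ^ n - r ^ n"
    by (intro power_increment_mono w) auto
  have "((plane_norm c n s t)\<^sup>2) ^ n = k + (s\<^sup>2 + c\<^sup>2 * t\<^sup>2) ^ n"
    using plane_norm_power[OF c n, of s t] by (simp add: k_def power_mult)
  also have "\<dots> \<le> k + (a\<^sup>2 + w) ^ n"
    using s by (intro add_left_mono power_mono) (auto simp: w_def)
  also have "\<dots> \<le> (a\<^sup>2 + r) ^ n" using step rn by simp
  finally have "((plane_norm c n s t)\<^sup>2) ^ Suc (n - 1) \<le> (a\<^sup>2 + r) ^ Suc (n - 1)"
    using n by simp
  then have "(plane_norm c n s t)\<^sup>2 \<le> a\<^sup>2 + r"
    by (rule power_le_imp_le_base) (simp add: r)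
  then show ?thesis by (simp add: r_def)
qed

section \<open>Iterated norms of heads and tails\<close>

definition head :: "nat \<Rightarrow> (nat \<Rightarrow> real) \<Rightarrow> nat \<Rightarrow> real" where
  "head m x = (\<lambda>j. if j \<le> m then x j else 0)"

definition tail :: "nat \<Rightarrow> (nat \<Rightarrow> real) \<Rightarrow> nat \<Rightarrow> real" where
  "tail m x = (\<lambda>j. if j \<le> m then 0 else x j)"

lemma iterated_norm_cong:
  assumes "\<And>j. j \<le> n \<Longrightarrow> x j = y j"
  shows "iterated_norm N n x = iterated_norm N n y"
  using assms by (induction n) auto

lemma iterated_norm_nonneg:
  assumes "0 < c" "c < 1"
  shows "0 \<le> iterated_norm (plane_norm c) n x"
  using assms by (cases n) (auto simp: plane_norm_nonneg)

lemma iterated_norm_mono_index: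
  assumes c: "0 < c" "c < 1" and "k \<le> n"
  shows "iterated_norm (plane_norm c) k x \<le> iterated_norm (plane_norm c) n x"
  using \<open>k \<le> n\<close>
proof (induction n rule: dec_induct)
  case (step n)
  have "iterated_norm (plane_norm c) n x \<le> iterated_norm (plane_norm c) (Suc n) x"
    using c by (auto intro: le_plane_norm iterated_norm_nonneg)
  with step show ?case by linarith
qed simp

lemma abs_entry_le_iterated_norm:
  assumes "0 < c" "c < 1"
  shows "\<bar>x n\<bar> \<le> iterated_norm (plane_norm c) n x"
proof (cases n)
  case (Suc k)
  then show ?thesis
    using abs_le_plane_norm[of c "Suc k" "iterated_norm (plane_norm c) k x" "\<bar>x n\<bar>"] assms
    by (simp add: iterated_norm_nonneg)
qed simp

lemma iterated_norm_mono:
  assumes c: "0 < c" "c < 1" and le: "\<And>j. \<bar>x j\<bar> \<le> \<bar>y j\<bar>"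
  shows "iterated_norm (plane_norm c) n x \<le> iterated_norm (plane_norm c) n y"
proof (induction n)
  case (Suc n)
  then show ?case
    using c le by (auto intro!: plane_norm_mono iterated_norm_nonneg)
qed (use le in simp)

lemma iterated_norm_upper_2_estimate:
  assumes c: "0 < c" "c < 1"
  shows "(iterated_norm (plane_norm c) n (\<lambda>j. head m x j + tail m y j))\<^sup>2
    \<le> (iterated_norm (plane_norm c) n (head m x))\<^sup>2 + (iterated_norm (plane_norm c) n (tail m y))\<^sup>2"
proof (induction n)
  case 0
  show ?case by (simp add: head_def tail_def)
next
  case (Suc n)
  let ?M = "iterated_norm (plane_norm c)"
  show ?case
  proof (cases "Suc n \<le> m")
    case True
    then have "?M (Suc n) (\<lambda>j. head m x j + tail m y j) = ?M (Suc n) (head m x)"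
      by (intro iterated_norm_cong) (auto simp: tail_def)
    then show ?thesis by simp
  next
    case False
    then have "head m x (Suc n) = 0" by (simp add: head_def)
    moreover have "(plane_norm c (Suc n) (?M n (\<lambda>j. head m x j + tail m y j)) \<bar>tail m y (Suc n)\<bar>)\<^sup>2
        \<le> (?M n (head m x))\<^sup>2 + (plane_norm c (Suc n) (?M n (tail m y)) \<bar>tail m y (Suc n)\<bar>)\<^sup>2"
      using c Suc by (intro plane_norm_upper_2_estimate) auto
    ultimately show ?thesis by (simp add: plane_norm_zero)
  qed
qed

section \<open>Norms of finitely supported sequences\<close>

lemma c00_bounded_support: "x \<in> c00 \<Longrightarrow> \<exists>n. \<forall>j>n. x j = 0"
  unfolding c00_def by (metis (mono_tags, lifting) finite_nat_set_iff_bounded_le mem_Collect_eq not_le)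

lemma head_in_c00: "head m x \<in> c00"
  unfolding c00_def head_def by (auto intro: finite_subset[of _ "{..m}"])

lemma tail_in_c00: "x \<in> c00 \<Longrightarrow> tail m x \<in> c00"
  unfolding c00_def tail_def by (auto elim: rev_finite_subset)

lemma head_eq_self: "\<forall>j>n. x j = 0 \<Longrightarrow> head n x = x"
  by (auto simp: head_def fun_eq_iff)

lemma c00_norm_mono:
  assumes c: "0 < c" "c < 1" and y: "y \<in> c00" and le: "\<And>j. \<bar>x j\<bar> \<le> \<bar>y j\<bar>"
  shows "c00_norm (plane_norm c) x \<le> c00_norm (plane_norm c) y"
proof -
  obtain n where n: "\<forall>j>n. y j = 0" using c00_bounded_support[OF y] by blast
  have "x j = 0" if "j > n" for j using le[of j] n that by simp
  then have "\<forall>j>n. x j = 0" by blast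
  with n show ?thesis
    using iterated_norm_mono[OF c le] by (simp add: c00_norm_plane_norm[OF c])
qed

lemma c00_norm_upper_2_estimate:
  assumes c: "0 < c" "c < 1" and y: "y \<in> c00"
  shows "(c00_norm (plane_norm c) (\<lambda>j. head m x j + tail m y j))\<^sup>2
    \<le> (c00_norm (plane_norm c) (head m x))\<^sup>2 + (c00_norm (plane_norm c) (tail m y))\<^sup>2"
proof -
  obtain n where n: "\<forall>j>n. y j = 0" using c00_bounded_support[OF y] by blast
  let ?n = "max m n"
  have "\<forall>j>?n. head m x j = 0" "\<forall>j>?n. tail m y j = 0"
    using n by (auto simp: head_def tail_def)
  then show ?thesis
    using iterated_norm_upper_2_estimate[OF c, of ?n m x y]
    by (simp add: c00_norm_plane_norm[OF c, of ?n])
qed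

section \<open>The canonical basis of the completion\<close>

lemma completion_add:
  "is_completion N \<iota> \<Longrightarrow> x \<in> c00 \<Longrightarrow> y \<in> c00 \<Longrightarrow> \<iota> (\<lambda>j. x j + y j) = \<iota> x + \<iota> y"
  unfolding is_completion_def by blast

lemma completion_scale:
  "is_completion N \<iota> \<Longrightarrow> x \<in> c00 \<Longrightarrow> \<iota> (\<lambda>j. a * x j) = a *\<^sub>R \<iota> x"
  unfolding is_completion_def by blast

lemma completion_norm: "is_completion N \<iota> \<Longrightarrow> x \<in> c00 \<Longrightarrow> norm (\<iota> x) = c00_norm N x"
  unfolding is_completion_def by blast

lemma completion_dense: "is_completion N \<iota> \<Longrightarrow> closure (\<iota> ` c00) = UNIV"
  unfolding is_completion_def by blast

lemma completion_head:
  assumes \<iota>: "is_completion N \<iota>"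
  shows "\<iota> (head n b) = (\<Sum>j\<le>n. b j *\<^sub>R canonical_basis \<iota> j)"
proof -
  have unit: "(\<lambda>i. if i = j then 1 else 0) \<in> c00" for j :: nat
    by (simp add: c00_def)
  have single: "\<iota> (\<lambda>i. b j * (if i = j then 1 else 0)) = b j *\<^sub>R canonical_basis \<iota> j" for j
    using completion_scale[OF \<iota> unit] by (simp add: canonical_basis_def)
  show ?thesis
  proof (induction n)
    case 0
    have "head 0 b = (\<lambda>i. b 0 * (if i = 0 then 1 else 0))" by (auto simp: head_def)
    then show ?case using single by simp
  next
    case (Suc n)
    have "(\<lambda>i. b (Suc n) * (if i = Suc n then 1 else 0)) \<in> c00"
      by (auto simp: c00_def intro: finite_subset[of _ "{Suc n}"])
    from completion_add[OF \<iota> head_in_c00 this]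
    have "\<iota> (\<lambda>i. head n b i + b (Suc n) * (if i = Suc n then 1 else 0))
        = \<iota> (head n b) + b (Suc n) *\<^sub>R canonical_basis \<iota> (Suc n)"
      by (simp only: single)
    moreover have "(\<lambda>i. head n b i + b (Suc n) * (if i = Suc n then 1 else 0)) = head (Suc n) b"
      by (auto simp: head_def fun_eq_iff le_Suc_eq)
    ultimately show ?case using Suc by simp
  qed
qed

text \<open>
  Coefficients are unique because the norms of the partial sums of a series dominate each of its
  coefficients: from index \<open>k\<close> on they are at least \<open>\<bar>b k\<bar>\<close>, while those of a null series
  tend to 0.
\<close>

lemma canonical_basis_null_series:
  assumes c: "0 < c" "c < 1" and \<iota>: "is_completion (plane_norm c) \<iota>"
    and sums: "(\<lambda>j. b j *\<^sub>R canonical_basis \<iota> j) sums 0"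
  shows "b k = 0"
proof -
  have "(\<lambda>n. \<iota> (head n b)) \<longlonglongrightarrow> 0"
    using sums by (simp add: sums_def_le completion_head[OF \<iota>])
  then have lim: "(\<lambda>n. norm (\<iota> (head n b))) \<longlonglongrightarrow> 0" by (rule tendsto_norm_zero)
  have "\<bar>b k\<bar> \<le> norm (\<iota> (head n b))" if "k \<le> n" for n
  proof -
    have "\<bar>head n b k\<bar> \<le> iterated_norm (plane_norm c) k (head n b)"
      by (rule abs_entry_le_iterated_norm[OF c])
    also have "\<dots> \<le> iterated_norm (plane_norm c) n (head n b)"
      by (rule iterated_norm_mono_index[OF c that])
    also have "\<dots> = norm (\<iota> (head n b))"
      using c00_norm_plane_norm[OF c, of n "head n b"] completion_norm[OF \<iota> head_in_c00]
      by (simp add: head_def)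
    finally show ?thesis using that by (simp add: head_def)
  qed
  then have "\<bar>b k\<bar> \<le> 0"
    by (intro tendsto_lowerbound[OF lim]) (auto simp: eventually_sequentially)
  then show ?thesis by simp
qed

lemma basis_coeff_completion:
  assumes c: "0 < c" "c < 1" and \<iota>: "is_completion (plane_norm c) \<iota>" and x: "x \<in> c00"
  shows "basis_coeff (canonical_basis \<iota>) (\<iota> x) = x"
  unfolding basis_coeff_def
proof (rule the_equality)
  obtain n where n: "\<forall>j>n. x j = 0" using c00_bounded_support[OF x] by blast
  have "(\<lambda>j. x j *\<^sub>R canonical_basis \<iota> j) sums (\<Sum>j\<le>n. x j *\<^sub>R canonical_basis \<iota> j)"
    by (rule sums_finite) (use n in auto)
  then show x_sums: "(\<lambda>j. x j *\<^sub>R canonical_basis \<iota> j) sums \<iota> x"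
    using completion_head[OF \<iota>, of n x] by (simp add: head_eq_self[OF n])
  fix a assume "(\<lambda>j. a j *\<^sub>R canonical_basis \<iota> j) sums \<iota> x"
  from sums_diff[OF this x_sums]
  have "(\<lambda>j. (a j - x j) *\<^sub>R canonical_basis \<iota> j) sums 0"
    by (simp add: scaleR_left_diff_distrib)
  from canonical_basis_null_series[OF c \<iota> this] show "a = x" by (auto simp: fun_eq_iff)
qed

lemma basis_proj_completion:
  assumes "0 < c" "c < 1" "is_completion (plane_norm c) \<iota>" "x \<in> c00"
  shows "basis_proj (canonical_basis \<iota>) m (\<iota> x) = \<iota> (head m x)"
  using assms by (simp add: basis_proj_def basis_coeff_completion completion_head)

section \<open>Duality\<close>

lemma norm_blinfun_add_le:
  fixes f :: "'a::real_normed_vector \<Rightarrow>\<^sub>L real" and g :: "'b::real_normed_vector \<Rightarrow>\<^sub>L real"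
  assumes le: "\<And>x y. norm x \<le> 1 \<Longrightarrow> norm y \<le> 1 \<Longrightarrow> f x + g y \<le> K"
  shows "norm f + norm g \<le> K"
proof -
  have norm_le: "norm h \<le> L" if "\<And>z. norm z \<le> 1 \<Longrightarrow> h z \<le> L"
    for h :: "'c::real_normed_vector \<Rightarrow>\<^sub>L real" and L
  proof (rule norm_blinfun_bound)
    show "0 \<le> L" using that[of 0] by (simp add: blinfun.zero_right)
    fix z
    have "h (sgn z) \<le> L" "h (- sgn z) \<le> L" by (auto intro!: that simp: norm_sgn)
    then have "\<bar>h (sgn z)\<bar> \<le> L" by (simp add: blinfun.minus_right)
    then have "norm z * \<bar>h (sgn z)\<bar> \<le> norm z * L" by (intro mult_left_mono) auto
    then have "\<bar>h (norm z *\<^sub>R sgn z)\<bar> \<le> L * norm z"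
      by (simp add: blinfun.scaleR_right abs_mult mult.commute)
    then show "norm (h z) \<le> L * norm z" by (cases "z = 0") (simp_all add: sgn_div_norm)
  qed
  have "norm f \<le> K - g y" if "norm y \<le> 1" for y
    using le[OF _ that] by (intro norm_le) (simp add: le_diff_eq)
  then have "norm g \<le> K - norm f"
    by (intro norm_le) (simp add: le_diff_eq add.commute)
  then show ?thesis by simp
qed

text \<open>
  Testing the hypothesis on vectors of norms at most \<open>\<parallel>f\<parallel>\<close> and \<open>\<parallel>g\<parallel>\<close> gives
  \<open>\<parallel>f\<parallel>\<^sup>2 + \<parallel>g\<parallel>\<^sup>2 \<le> H sqrt (\<parallel>f\<parallel>\<^sup>2 + \<parallel>g\<parallel>\<^sup>2)\<close>.
\<close>

lemma norm_blinfun_sq_add_le: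
  fixes f :: "'a::real_normed_vector \<Rightarrow>\<^sub>L real" and g :: "'b::real_normed_vector \<Rightarrow>\<^sub>L real"
  assumes H: "0 \<le> H" and le: "\<And>x y. f x + g y \<le> H * sqrt ((norm x)\<^sup>2 + (norm y)\<^sup>2)"
  shows "(norm f)\<^sup>2 + (norm g)\<^sup>2 \<le> H\<^sup>2"
proof -
  define S where "S = sqrt ((norm f)\<^sup>2 + (norm g)\<^sup>2)"
  have S: "0 \<le> S" "S\<^sup>2 = (norm f)\<^sup>2 + (norm g)\<^sup>2" by (simp_all add: S_def)
  have "norm (norm f *\<^sub>R f) + norm (norm g *\<^sub>R g) \<le> H * S"
  proof (rule norm_blinfun_add_le)
    fix x :: 'a and y :: 'b assume "norm x \<le> 1" "norm y \<le> 1"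
    then have "norm (norm f *\<^sub>R x) \<le> norm f" "norm (norm g *\<^sub>R y) \<le> norm g"
      by (simp_all add: mult_left_le)
    then have "sqrt ((norm (norm f *\<^sub>R x))\<^sup>2 + (norm (norm g *\<^sub>R y))\<^sup>2) \<le> S"
      unfolding S_def by (intro real_sqrt_le_mono add_mono power_mono) auto
    with le[of "norm f *\<^sub>R x" "norm g *\<^sub>R y"] H
    show "(norm f *\<^sub>R f) x + (norm g *\<^sub>R g) y \<le> H * S"
      by (auto simp: blinfun.scaleR_left blinfun.scaleR_right intro: order_trans mult_left_mono)
  qed
  then have "S * S \<le> H * S" using S(2) by (simp add: power2_eq_square)
  with S(1) H have "S \<le> H" by (cases "S = 0") auto
  with S show ?thesis by (metis power_mono)
qed

theorem proposition5p2:
  fixes c :: real and m :: nat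
    and \<iota> :: "(nat \<Rightarrow> real) \<Rightarrow> 'a::banach"
    and f g :: "'a \<Rightarrow>\<^sub>L real"
  assumes "0 < c" and "c < 1"
    and "is_completion (plane_norm c) \<iota>"
    and "dual_adjoint (basis_proj (canonical_basis \<iota>) m) f = blinfun_apply f"
    and "dual_adjoint (basis_proj (canonical_basis \<iota>) m) g = (\<lambda>x. 0)"
  shows "(norm (f + g))\<^sup>2 \<ge> (norm f)\<^sup>2 + (norm g)\<^sup>2"
proof -
  note c = assms(1,2) and \<iota> = assms(3)
  have proj: "basis_proj (canonical_basis \<iota>) m (\<iota> x) = \<iota> (head m x)" if "x \<in> c00" for x
    by (rule basis_proj_completion[OF c \<iota> that])
  have f_head: "f (\<iota> (head m x)) = f (\<iota> x)" if "x \<in> c00" for x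
    using fun_cong[OF assms(4), of "\<iota> x"] proj[OF that] by (simp add: dual_adjoint_def)
  have g_head: "g (\<iota> (head m x)) = 0" if "x \<in> c00" for x
    using fun_cong[OF assms(5), of "\<iota> x"] proj[OF that] by (simp add: dual_adjoint_def)
  have split: "\<iota> x = \<iota> (head m x) + \<iota> (tail m x)" if "x \<in> c00" for x
  proof -
    have "(\<lambda>j. head m x j + tail m x j) = x" by (auto simp: head_def tail_def)
    then show ?thesis using completion_add[OF \<iota> head_in_c00 tail_in_c00[OF that], of m x m] by simp
  qed
  have f_tail: "f (\<iota> (tail m x)) = 0" and g_tail: "g (\<iota> (tail m x)) = g (\<iota> x)" if "x \<in> c00" for x
    using arg_cong[OF split[OF that], of f] arg_cong[OF split[OF that], of g]
      f_head[OF that] g_head[OF that]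
    unfolding blinfun.add_right by linarith+

  have glue: "f (\<iota> x) + g (\<iota> y) \<le> norm (f + g) * sqrt ((norm (\<iota> x))\<^sup>2 + (norm (\<iota> y))\<^sup>2)"
    if x: "x \<in> c00" and y: "y \<in> c00" for x y
  proof -
    let ?u = "\<iota> (head m x)" and ?v = "\<iota> (tail m y)"
    note in_c00 = head_in_c00[of m x] tail_in_c00[OF y, of m]
    have sum_in_c00: "(\<lambda>j. head m x j + tail m y j) \<in> c00"
      unfolding c00_def mem_Collect_eq
      by (rule finite_subset[of _ "{..m} \<union> {j. y j \<noteq> 0}"])
        (use y in \<open>auto simp: c00_def head_def tail_def split: if_splits\<close>)
    have "f (\<iota> x) + g (\<iota> y) = (f + g) (?u + ?v)"
      by (simp add: blinfun.add_left blinfun.add_right f_head[OF x] f_tail[OF y] g_head[OF x]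
          g_tail[OF y])
    also have "\<dots> \<le> norm (f + g) * norm (?u + ?v)"
      using norm_blinfun[of "f + g" "?u + ?v"] by simp
    also have "norm (?u + ?v) \<le> sqrt ((norm ?u)\<^sup>2 + (norm ?v)\<^sup>2)"
      using c00_norm_upper_2_estimate[OF c y, of m x] completion_norm[OF \<iota>] in_c00 sum_in_c00
      by (intro real_le_rsqrt) (simp flip: completion_add[OF \<iota>])
    also have "\<dots> \<le> sqrt ((norm (\<iota> x))\<^sup>2 + (norm (\<iota> y))\<^sup>2)"
    proof -
      have "norm ?u \<le> norm (\<iota> x)" "norm ?v \<le> norm (\<iota> y)"
        using completion_norm[OF \<iota>] in_c00 x y
        by (auto simp: head_def tail_def intro!: c00_norm_mono[OF c])
      then show ?thesis by (intro real_sqrt_le_mono add_mono power_mono) auto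
    qed
    finally show ?thesis by (simp add: mult_left_mono)
  qed

  let ?C = "{p. f (fst p) + g (snd p) \<le> norm (f + g) * sqrt ((norm (fst p))\<^sup>2 + (norm (snd p))\<^sup>2)}"
  have "closed ?C"
    by (intro closed_Collect_le continuous_intros)
  moreover have "\<iota> ` c00 \<times> \<iota> ` c00 \<subseteq> ?C" using glue by auto
  ultimately have "closure (\<iota> ` c00 \<times> \<iota> ` c00) \<subseteq> ?C" by (intro closure_minimal)
  then have "?C = UNIV"
    by (auto simp: closure_Times completion_dense[OF \<iota>])
  then have "f x + g y \<le> norm (f + g) * sqrt ((norm x)\<^sup>2 + (norm y)\<^sup>2)" for x y
    by (auto dest: equalityD2[THEN subsetD, of _ _ "(x, y)"])
  then show ?thesis by (intro norm_blinfun_sq_add_le) auto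
qed

end
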